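(* Let $n\ge 2$ and let $D_n$ be the degree of a fixed vertex of the Moran forest $\mathscr{F}_n$. Then: (i) $\mathbb{E}[D_n] = 1$. (ii) $\mathrm{Var}(D_n) = \dfrac{2(n-2)}{3(n-1)}$. (iii) $\displaystyle G_{D_n}(z) := \mathbb{E}\bigl[z^{D_n}\bigr] = \frac1n\sum_{\ell=0}^{n-1}\Bigl(1+\bigl(1-\tfrac{\ell}{n-1}\bigr)(z-1)\Bigr)\Bigl(1+\tfrac{1}{n-1}(z-1)\Bigr)^{\ell}$. (iii') $\displaystyle G_{D_n}(z) = 2\Bigl(1-\frac1n\Bigr)\frac{\bigl(1+\frac{z-1}{n-1}\bigr)^n-1}{z-1} - 1$ (with the value at $z=1$ understood by continuity).
   Context: Moran forest: for fixed $n\ge 2$, consider the Markov chain on directed graphs on $\{1,\ldots,n\}$ whose transitions are: at each time-step, choose an ordered pair of distinct vertices $(u,v)$ uniformly at random; disconnect $v$ from all of its neighbors (remove all edges incident to $v$), then add the edge $\vec{uv}$. This chain has a unique stationary distribution, whose support is the set of non-empty rooted forests (those with at least one edge) on $\{1,\ldots,n\}$. The Moran forest $\mathscr{F}_n$ is a random forest having this stationary distribution. The degree of a vertex is its total degree (in-degree plus out-degree); by exchangeability its law does not depend on the chosen vertex. *)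

theory Defs
  imports "HOL-Probability.Probability" "Graph_Theory.Pair_Digraph"
begin

definition digraphs_on :: "nat \<Rightarrow> nat pair_pre_digraph set" where
  "digraphs_on n = {G. pair_digraph G \<and> pverts G = {1..n}}"

definition moran_update :: "nat \<times> nat \<Rightarrow> nat pair_pre_digraph \<Rightarrow> nat pair_pre_digraph" where
  "moran_update = (\<lambda>(u, v) G. G\<lparr>parcs :=
     insert (u, v) (parcs G - (in_arcs (with_proj G) v \<union> out_arcs (with_proj G) v))\<rparr>)"

definition moran_step :: "nat \<Rightarrow> nat pair_pre_digraph \<Rightarrow> nat pair_pre_digraph pmf" where
  "moran_step n G = map_pmf (\<lambda>e. moran_update e G)
     (pmf_of_set {(u, v). u \<in> {1..n} \<and> v \<in> {1..n} \<and> u \<noteq> v})"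

definition moran_stationary :: "nat \<Rightarrow> nat pair_pre_digraph pmf \<Rightarrow> bool" where
  "moran_stationary n P \<longleftrightarrow>
     set_pmf P \<subseteq> digraphs_on n \<and> bind_pmf P (moran_step n) = P"

(* The law of the Moran forest. The description is proper only for n >= 2: for n < 2 there is
   no ordered pair of distinct vertices to choose from. *)
definition moran_forest :: "nat \<Rightarrow> nat pair_pre_digraph pmf" where
  "moran_forest n = (THE P. moran_stationary n P)"

definition total_degree :: "nat pair_pre_digraph \<Rightarrow> nat \<Rightarrow> nat" where
  "total_degree G v = in_degree (with_proj G) v + out_degree (with_proj G) v"

definition moran_degree_pgf :: "nat \<Rightarrow> nat \<Rightarrow> complex \<Rightarrow> complex" where
  "moran_degree_pgf n v z =
     measure_pmf.expectation (moran_forest n) (\<lambda>F. z ^ total_degree F v)"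

end

theory Submission
  imports Defs
begin

text \<open>
The degree \<open>D\<close> of a fixed vertex \<open>v\<close> evolves as a Markov chain of its own under the Moran updates.
From degree \<open>d\<close>, and up to the factor \<open>n(n - 1)\<close>, it is reset to 1 with weight \<open>n - 1\<close> (the target is
\<open>v\<close>), drops to \<open>d - 1\<close> with weight \<open>d(n - 2)\<close> (a neighbour is taken away by another vertex) and rises
to \<open>d + 1\<close> with weight \<open>n - 1 - d\<close> (\<open>v\<close> takes a vertex that was not its neighbour); see
\<open>expectation_degree_step\<close>. Testing stationarity against the functions \<open>d choose k\<close> makes this
chain triangular, and the binomial moments \<open>\<mu>\<^sub>k = E(D choose k)\<close> satisfy the two-term recursion
\<open>(k + 1)(n - 1) \<mu>\<^sub>k = (n - k) \<mu>\<^sub>k\<^sub>-\<^sub>1 + (n - 1)(1 choose k)\<close> for \<open>k \<ge> 1\<close>. The cases \<open>k = 1, 2\<close> give the mean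
and the variance.

For all \<open>k\<close> the solution is \<open>n (n - 1)^k \<mu>\<^sub>k = 2 (n choose (k + 1))\<close>, with \<open>\<mu>\<^sub>0 + 1\<close> in place of \<open>\<mu>\<^sub>0\<close>. Since
\<open>G(z) = \<Sum> \<mu>\<^sub>k (z - 1)^k\<close>, this says that \<open>n (G + 1)\<close> is \<open>2 ((1 + x)^n - 1) / x\<close> in the variable
\<open>x = (z - 1) / (n - 1)\<close> (\<open>degree_pgf_binomial\<close>), which is the quotient formula. Written as a
geometric sum in \<open>1 + x\<close>, it differs from the weighted sum over \<open>l\<close> by a telescoping sum
(\<open>weighted_geometric_sum\<close>).

All this presupposes that the stationary law exists, is unique, and charges no graph with a pair of
antiparallel arcs, because for such graphs the degree would not be the number of neighbours. All
three facts come from one convergence theorem for finite chains. Updating with the pairs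
\<open>(1, 2), \<dots>, (1, n)\<close> turns every graph into the star with centre 1, so one state is reachable from
all others in \<open>n - 1\<close> steps, and the chain forgets its initial state geometrically fast. The theorem is
applied to the set of all graphs for uniqueness and to the closed subset without antiparallel arcs
for existence (\<open>moran_forest_stationary\<close>).
\<close>

section \<open>Convergence of finite Markov chains\<close>

definition chain_law :: "('a \<Rightarrow> 'a pmf) \<Rightarrow> nat \<Rightarrow> 'a \<Rightarrow> 'a pmf" where
  "chain_law K k x = ((\<lambda>P. bind_pmf P K) ^^ k) (return_pmf x)"

lemma chain_law_0 [simp]: "chain_law K 0 x = return_pmf x"
  by (simp add: chain_law_def)

lemma chain_law_Suc: "chain_law K (Suc k) x = bind_pmf (chain_law K k x) K"
  by (simp add: chain_law_def)

lemma chain_law_add: "chain_law K (j + k) x = bind_pmf (chain_law K j x) (chain_law K k)"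
proof (induction k)
  case 0
  then show ?case by (simp add: bind_return_pmf')
next
  case (Suc k)
  then show ?case by (simp add: chain_law_Suc bind_assoc_pmf)
qed

lemma bind_chain_law_stationary:
  assumes "bind_pmf P K = P"
  shows "bind_pmf P (chain_law K k) = P"
proof (induction k)
  case 0
  then show ?case by (simp add: bind_return_pmf')
next
  case (Suc k)
  then show ?case by (simp add: chain_law_Suc bind_assoc_pmf[symmetric] assms)
qed

text \<open>Doeblin's condition in its simplest form: on a finite closed set of states, one state \<^term>\<open>s\<close>
can be reached from everywhere in the same number of steps. It forces the law after \<open>k\<close> steps to
forget the initial state geometrically fast, which gives existence and uniqueness of the
stationary law together.\<close>
locale finite_doeblin_chain =
  fixes K :: "'a \<Rightarrow> 'a pmf" and S :: "'a set" and s :: 'a and m :: nat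
  assumes finite_S: "finite S"
    and s_in_S: "s \<in> S"
    and closed: "x \<in> S \<Longrightarrow> set_pmf (K x) \<subseteq> S"
    and reach: "x \<in> S \<Longrightarrow> s \<in> set_pmf (chain_law K m x)"
begin

lemma chain_law_closed: "x \<in> S \<Longrightarrow> set_pmf (chain_law K k x) \<subseteq> S"
proof (induction k)
  case (Suc k)
  then show ?case using closed by (fastforce simp: chain_law_Suc)
qed simp

lemma expectation_eq_sum:
  fixes f :: "'a \<Rightarrow> real"
  assumes "set_pmf P \<subseteq> S"
  shows "measure_pmf.expectation P f = (\<Sum>x\<in>S. f x * pmf P x)"
  using assms finite_S by (intro integral_measure_pmf_real) auto

lemma sum_pmf_S: "set_pmf P \<subseteq> S \<Longrightarrow> (\<Sum>x\<in>S. pmf P x) = 1"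
  using finite_S by (rule sum_pmf_eq_1)

text \<open>An atom of mass at least \<open>e\<close> at \<open>s\<close> pulls the mean of \<open>f\<close> towards \<open>f s\<close>. Together with
the mirror image below, this traps the mean in an interval whose length is shorter than that of the
range of \<open>f\<close> by the factor \<open>1 - e\<close>, and that interval depends on the law only through \<open>e\<close>.\<close>
lemma expectation_ge_atom:
  fixes f :: "'a \<Rightarrow> real"
  assumes "set_pmf P \<subseteq> S" "e \<le> pmf P s" "\<And>x. x \<in> S \<Longrightarrow> a \<le> f x"
  shows "a + e * (f s - a) \<le> measure_pmf.expectation P f"
proof -
  have "e * (f s - a) \<le> (f s - a) * pmf P s"
    using mult_right_mono[OF assms(2), of "f s - a"] assms(3)[OF s_in_S] by (simp add: mult.commute)
  also have "\<dots> \<le> (\<Sum>x\<in>S. (f x - a) * pmf P x)"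
    using assms s_in_S finite_S by (intro member_le_sum) auto
  also have "\<dots> = measure_pmf.expectation P f - a"
    using assms(1) by (simp add: left_diff_distrib sum_subtractf expectation_eq_sum
        sum_pmf_S flip: sum_distrib_left)
  finally show ?thesis by simp
qed

lemma expectation_le_atom:
  fixes f :: "'a \<Rightarrow> real"
  assumes "set_pmf P \<subseteq> S" "e \<le> pmf P s" "\<And>x. x \<in> S \<Longrightarrow> f x \<le> b"
  shows "measure_pmf.expectation P f \<le> b - e * (b - f s)"
  using expectation_ge_atom[of P e "- b" "\<lambda>x. - f x"] assms by (simp add: algebra_simps)

definition minorant :: real where
  "minorant = Min ((\<lambda>x. pmf (chain_law K m x) s) ` S)"

lemma minorant_pos: "0 < minorant"
proof -
  have "Min ((\<lambda>x. pmf (chain_law K m x) s) ` S) \<in> (\<lambda>x. pmf (chain_law K m x) s) ` S"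
    using finite_S s_in_S by (intro Min_in) auto
  then obtain x where "x \<in> S" "minorant = pmf (chain_law K m x) s"
    unfolding minorant_def by blast
  then show ?thesis using reach by (simp add: pmf_positive)
qed

lemma minorant_le: "x \<in> S \<Longrightarrow> minorant \<le> pmf (chain_law K m x) s"
  unfolding minorant_def using finite_S by (intro Min_le) auto

lemma minorant_le_1: "minorant \<le> 1"
  using minorant_le[OF s_in_S] by (rule order_trans) (rule pmf_le_1)

text \<open>Each block of \<open>m\<close> steps shrinks the range of \<open>x \<mapsto> P\<^sub>x(X\<^sub>k = y)\<close> by the factor
\<^term>\<open>1 - minorant\<close>, by the two atom bounds applied to the law after \<open>m\<close> steps.\<close>
lemma oscillation_block:
  "\<exists>a b. b - a = (1 - minorant) ^ j \<and> (\<forall>x\<in>S. pmf (chain_law K (m * j) x) y \<in> {a..b})"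
proof (induction j)
  case 0
  show ?case by (intro exI[of _ 0] exI[of _ 1]) (simp add: pmf_le_1)
next
  case (Suc j)
  then obtain a b where ab: "b - a = (1 - minorant) ^ j"
    "\<And>x. x \<in> S \<Longrightarrow> pmf (chain_law K (m * j) x) y \<in> {a..b}" by blast
  let ?f = "\<lambda>x. pmf (chain_law K (m * j) x) y"
  let ?a = "a + minorant * (?f s - a)" and ?b = "b - minorant * (b - ?f s)"
  have "?b - ?a = (1 - minorant) * (b - a)" by (simp add: algebra_simps)
  moreover have "pmf (chain_law K (m * Suc j) x) y \<in> {?a..?b}" if "x \<in> S" for x
    using that ab(2) expectation_ge_atom[of "chain_law K m x" minorant a ?f]
      expectation_le_atom[of "chain_law K m x" minorant ?f b]
    by (simp add: chain_law_add pmf_bind minorant_le chain_law_closed)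
  ultimately show ?case using ab(1) by (intro exI[of _ ?a] exI[of _ ?b]) simp
qed

text \<open>Once the probabilities of hitting \<open>y\<close> lie in an interval for all initial states, they stay there:
any initial law, and any further steps taken beforehand, only average them.\<close>
lemma oscillation_tail:
  "\<exists>a b. b - a = (1 - minorant) ^ j \<and>
    (\<forall>P. set_pmf P \<subseteq> S \<longrightarrow> (\<forall>k\<ge>m * j. pmf (bind_pmf P (chain_law K k)) y \<in> {a..b}))"
proof -
  obtain a b where ab: "b - a = (1 - minorant) ^ j"
    "\<And>x. x \<in> S \<Longrightarrow> pmf (chain_law K (m * j) x) y \<in> {a..b}"
    using oscillation_block by blast
  have "pmf (bind_pmf P (chain_law K k)) y \<in> {a..b}"
    if P: "set_pmf P \<subseteq> S" and k: "m * j \<le> k" for P k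
  proof -
    define Q where "Q = bind_pmf P (chain_law K (k - m * j))"
    have Q: "set_pmf Q \<subseteq> S" using P chain_law_closed by (fastforce simp: Q_def)
    have "chain_law K k = (\<lambda>x. bind_pmf (chain_law K (k - m * j) x) (chain_law K (m * j)))"
      using k chain_law_add[of K "k - m * j" "m * j"] by (simp add: fun_eq_iff)
    then have "bind_pmf P (chain_law K k) = bind_pmf Q (chain_law K (m * j))"
      by (simp add: Q_def bind_assoc_pmf)
    then show ?thesis
      using Q ab(2) expectation_ge_atom[of Q 0 a "\<lambda>x. pmf (chain_law K (m * j) x) y"]
        expectation_le_atom[of Q 0 "\<lambda>x. pmf (chain_law K (m * j) x) y" b]
      by (simp add: pmf_bind)
  qed
  then show ?thesis using ab(1) by blast
qed

lemma oscillation_small: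
  assumes "0 < e"
  shows "\<exists>N. \<forall>P Q k l. set_pmf P \<subseteq> S \<longrightarrow> set_pmf Q \<subseteq> S \<longrightarrow> N \<le> k \<longrightarrow> N \<le> l \<longrightarrow>
    dist (pmf (bind_pmf P (chain_law K k)) y) (pmf (bind_pmf Q (chain_law K l)) y) < e"
proof -
  obtain j where j: "(1 - minorant) ^ j < e"
    using real_arch_pow_inv[OF assms, of "1 - minorant"] minorant_pos by auto
  obtain a b where ab: "b - a = (1 - minorant) ^ j"
    "\<And>P k. set_pmf P \<subseteq> S \<Longrightarrow> m * j \<le> k \<Longrightarrow> pmf (bind_pmf P (chain_law K k)) y \<in> {a..b}"
    using oscillation_tail by blast
  have "dist (pmf (bind_pmf P (chain_law K k)) y) (pmf (bind_pmf Q (chain_law K l)) y) < e"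
    if "set_pmf P \<subseteq> S" "set_pmf Q \<subseteq> S" "m * j \<le> k" "m * j \<le> l" for P Q k l
    using ab(2)[OF that(1,3)] ab(2)[OF that(2,4)] ab(1) j unfolding dist_real_def atLeastAtMost_iff by linarith
  then show ?thesis by blast
qed

theorem stationary_unique:
  assumes "set_pmf P \<subseteq> S" "bind_pmf P K = P" "set_pmf Q \<subseteq> S" "bind_pmf Q K = Q"
  shows "P = Q"
proof (rule pmf_eqI, rule ccontr)
  fix y assume "pmf P y \<noteq> pmf Q y"
  then have "0 < dist (pmf P y) (pmf Q y)" by simp
  from oscillation_small[OF this, of y] assms(1,3)
  obtain k where "dist (pmf (bind_pmf P (chain_law K k)) y) (pmf (bind_pmf Q (chain_law K k)) y)
      < dist (pmf P y) (pmf Q y)"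
    by blast
  then show False by (simp add: bind_chain_law_stationary assms(2,4))
qed

text \<open>The laws of the chain started at \<open>s\<close> are pointwise Cauchy, and on a finite set their limit is
again a probability law. It is stationary because one step is a finite sum and so commutes with the
limit.\<close>
theorem stationary_exists: "\<exists>P. set_pmf P \<subseteq> S \<and> bind_pmf P K = P"
proof -
  define p where "p k y = pmf (chain_law K k s) y" for k y
  have law_S: "set_pmf (chain_law K k s) \<subseteq> S" for k
    using chain_law_closed[OF s_in_S] .
  have "Cauchy (\<lambda>k. p k y)" for y
    unfolding Cauchy_def
  proof (intro allI impI)
    fix e :: real assume "0 < e"
    then obtain M where "\<And>k l. M \<le> k \<Longrightarrow> M \<le> l \<Longrightarrow>
        dist (pmf (bind_pmf (return_pmf s) (chain_law K k)) y)
             (pmf (bind_pmf (return_pmf s) (chain_law K l)) y) < e"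
      using oscillation_small[of e y] s_in_S by (metis set_return_pmf empty_subsetI insert_subset)
    then show "\<exists>M. \<forall>k\<ge>M. \<forall>l\<ge>M. dist (p k y) (p l y) < e"
      unfolding p_def bind_return_pmf by blast
  qed
  then have "\<forall>y. \<exists>L. (\<lambda>k. p k y) \<longlonglongrightarrow> L"
    using Cauchy_convergent convergent_def by blast
  then obtain q where q: "\<And>y. (\<lambda>k. p k y) \<longlonglongrightarrow> q y" by metis
  have q_nonneg: "0 \<le> q y" for y
    by (rule LIMSEQ_le_const[OF q]) (simp add: p_def)
  have q_outside: "q y = 0" if "y \<notin> S" for y
  proof -
    have "p k y = 0" for k using that law_S unfolding p_def pmf_eq_0_set_pmf by blast
    then show ?thesis using q[of y] by (simp add: LIMSEQ_const_iff)
  qed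
  have "(\<Sum>y\<in>S. p k y) = 1" for k
    unfolding p_def by (rule sum_pmf_S[OF law_S])
  moreover have "(\<lambda>k. \<Sum>y\<in>S. p k y) \<longlonglongrightarrow> (\<Sum>y\<in>S. q y)"
    by (intro tendsto_sum q)
  ultimately have q_sum: "(\<Sum>y\<in>S. q y) = 1" by (simp add: LIMSEQ_const_iff)
  have "(\<integral>\<^sup>+y. q y \<partial>count_space UNIV) = (\<Sum>y\<in>S. ennreal (q y))"
    using finite_S q_outside by (intro nn_integral_count_space') auto
  also have "\<dots> = 1"
    using q_sum q_nonneg by (simp add: sum_ennreal)
  finally have q_prob: "(\<integral>\<^sup>+y. q y \<partial>count_space UNIV) = 1" .
  define P where "P = embed_pmf q"
  have P: "pmf P y = q y" for y
    unfolding P_def using q_nonneg q_prob by (rule pmf_embed_pmf)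
  have PS: "set_pmf P \<subseteq> S"
    using q_outside P by (metis pmf_eq_0_set_pmf subsetI)
  have "bind_pmf P K = P"
  proof (rule pmf_eqI)
    fix y
    have "p (Suc k) y = (\<Sum>x\<in>S. pmf (K x) y * p k x)" for k
      by (simp add: p_def chain_law_Suc pmf_bind expectation_eq_sum[OF law_S])
    moreover have "(\<lambda>k. \<Sum>x\<in>S. pmf (K x) y * p k x) \<longlonglongrightarrow> (\<Sum>x\<in>S. pmf (K x) y * q x)"
      by (intro tendsto_intros q)
    ultimately have "(\<lambda>k. p (Suc k) y) \<longlonglongrightarrow> (\<Sum>x\<in>S. pmf (K x) y * q x)" by simp
    from LIMSEQ_unique[OF this LIMSEQ_Suc[OF q]]
    show "pmf (bind_pmf P K) y = pmf P y"
      by (simp add: pmf_bind P expectation_eq_sum[OF PS])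
  qed
  with PS show ?thesis by blast
qed

end

section \<open>The Moran chain on graphs\<close>

lemma digraphs_on_iff:
  "G \<in> digraphs_on n \<longleftrightarrow>
     pverts G = {1..n} \<and> parcs G \<subseteq> {1..n} \<times> {1..n} \<and> (\<forall>a. (a, a) \<notin> parcs G)"
proof
  assume "G \<in> digraphs_on n"
  then interpret pair_digraph G by (simp add: digraphs_on_def)
  show "pverts G = {1..n} \<and> parcs G \<subseteq> {1..n} \<times> {1..n} \<and> (\<forall>a. (a, a) \<notin> parcs G)"
    using \<open>G \<in> digraphs_on n\<close> by (force simp: digraphs_on_def dest: wellformed' pair_no_loops)
next
  assume G: "pverts G = {1..n} \<and> parcs G \<subseteq> {1..n} \<times> {1..n} \<and> (\<forall>a. (a, a) \<notin> parcs G)"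
  then have "finite (parcs G)" using finite_subset by blast
  with G have "pair_digraph G" by unfold_locales auto
  with G show "G \<in> digraphs_on n" by (simp add: digraphs_on_def)
qed

lemma finite_digraphs_on: "finite (digraphs_on n)"
proof (rule finite_subset)
  show "digraphs_on n \<subseteq>
      (\<lambda>E. \<lparr>pverts = {1..n}, parcs = E\<rparr>) ` Pow ({1..n} \<times> {1..n})"
  proof
    fix G assume "G \<in> digraphs_on n"
    then have "G = \<lparr>pverts = {1..n}, parcs = parcs G\<rparr>" "parcs G \<in> Pow ({1..n} \<times> {1..n})"
      by (simp_all add: digraphs_on_iff)
    then show "G \<in> (\<lambda>E. \<lparr>pverts = {1..n}, parcs = E\<rparr>) ` Pow ({1..n} \<times> {1..n})"
      by (rule image_eqI)
  qed
qed simp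

lemma pverts_moran_update [simp]: "pverts (moran_update e G) = pverts G"
  by (simp add: moran_update_def split: prod.split)

lemma parcs_moran_update [simp]:
  "parcs (moran_update (u, w) G) = insert (u, w) {(a, b) \<in> parcs G. a \<noteq> w \<and> b \<noteq> w}"
  by (auto simp: moran_update_def)

definition vertex_pairs :: "nat \<Rightarrow> (nat \<times> nat) set" where
  "vertex_pairs n = {(u, w). u \<in> {1..n} \<and> w \<in> {1..n} \<and> u \<noteq> w}"

lemma vertex_pairs_Sigma:
  "vertex_pairs n = prod.swap ` (SIGMA w:{1..n}. {1..n} - {w})"
  by (force simp: vertex_pairs_def)

lemma sum_vertex_pairs:
  "(\<Sum>e\<in>vertex_pairs n. f e) = (\<Sum>w\<in>{1..n}. \<Sum>u\<in>{1..n} - {w}. f (u, w))"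
  unfolding vertex_pairs_Sigma by (subst sum.reindex) (simp_all add: sum.Sigma split_beta prod.swap_def)

lemma finite_vertex_pairs: "finite (vertex_pairs n)"
  by (simp add: vertex_pairs_Sigma)

lemma card_vertex_pairs: "card (vertex_pairs n) = n * (n - 1)"
  using sum_vertex_pairs[of "\<lambda>_. 1::nat" n] by simp

lemma vertex_pairs_nonempty: "n \<ge> 2 \<Longrightarrow> vertex_pairs n \<noteq> {}"
proof -
  assume "n \<ge> 2"
  then have "(1, 2) \<in> vertex_pairs n" by (simp add: vertex_pairs_def)
  then show ?thesis by blast
qed

lemma moran_step_eq:
  "moran_step n G = map_pmf (\<lambda>e. moran_update e G) (pmf_of_set (vertex_pairs n))"
  by (simp add: moran_step_def vertex_pairs_def)

lemma set_moran_step: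
  "n \<ge> 2 \<Longrightarrow> set_pmf (moran_step n G) = (\<lambda>e. moran_update e G) ` vertex_pairs n"
  by (simp add: moran_step_eq finite_vertex_pairs vertex_pairs_nonempty)

lemma expectation_moran_step:
  fixes f :: "nat pair_pre_digraph \<Rightarrow> real"
  assumes "n \<ge> 2"
  shows "measure_pmf.expectation (moran_step n G) f =
    (\<Sum>w\<in>{1..n}. \<Sum>u\<in>{1..n} - {w}. f (moran_update (u, w) G)) / (real n * (real n - 1))"
  using assms by (simp add: moran_step_eq integral_pmf_of_set finite_vertex_pairs
      vertex_pairs_nonempty card_vertex_pairs sum_vertex_pairs of_nat_diff)

lemma moran_step_digraphs_on:
  assumes "n \<ge> 2" "G \<in> digraphs_on n"
  shows "set_pmf (moran_step n G) \<subseteq> digraphs_on n"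
  using assms by (auto simp: set_moran_step vertex_pairs_def digraphs_on_iff)

text \<open>Graphs without antiparallel arcs. An update never creates a pair \<open>a \<rightarrow> b\<close>, \<open>b \<rightarrow> a\<close>, since the
target of the new arc has just been isolated. Forests are of this kind, but this much weaker
property is enough to make the degree of a vertex count its neighbours.\<close>
definition oriented_graphs_on :: "nat \<Rightarrow> nat pair_pre_digraph set" where
  "oriented_graphs_on n = {G \<in> digraphs_on n. \<forall>a b. (a, b) \<in> parcs G \<longrightarrow> (b, a) \<notin> parcs G}"

lemma moran_step_oriented_graphs_on:
  assumes "n \<ge> 2" "G \<in> oriented_graphs_on n"
  shows "set_pmf (moran_step n G) \<subseteq> oriented_graphs_on n"
  using assms moran_step_digraphs_on[of n G]
  by (auto simp: set_moran_step vertex_pairs_def oriented_graphs_on_def)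

definition star :: "nat \<Rightarrow> nat pair_pre_digraph" where
  "star n = \<lparr>pverts = {1..n}, parcs = {1} \<times> {2..n}\<rparr>"

lemma star_oriented: "n \<ge> 2 \<Longrightarrow> star n \<in> oriented_graphs_on n"
  by (auto simp: star_def oriented_graphs_on_def digraphs_on_iff)

text \<open>The updates \<open>(1, 2), (1, 3), \<dots>\<close> in turn wipe out all earlier arcs at their targets. The
invariant is that every arc at an already treated vertex comes from the vertex 1.\<close>
lemma partial_star_reachable:
  assumes "G \<in> digraphs_on n" "j \<le> n - 1"
  shows "\<exists>H\<in>set_pmf (chain_law (moran_step n) j G). H \<in> digraphs_on n \<and>
    {(a, b) \<in> parcs H. a \<in> {2..j + 1} \<or> b \<in> {2..j + 1}} = {1} \<times> {2..j + 1}"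
  using assms(2)
proof (induction j)
  case 0
  then show ?case using assms(1) by auto
next
  case (Suc j)
  then obtain H where H: "H \<in> set_pmf (chain_law (moran_step n) j G)" "H \<in> digraphs_on n"
    "{(a, b) \<in> parcs H. a \<in> {2..j + 1} \<or> b \<in> {2..j + 1}} = {1} \<times> {2..j + 1}"
    by auto
  have n: "n \<ge> 2" using Suc.prems by simp
  define H' where "H' = moran_update (1, j + 2) H"
  have H': "H' \<in> set_pmf (moran_step n H)"
    using n Suc.prems by (auto simp: H'_def set_moran_step vertex_pairs_def)
  have iff: "(a, b) \<in> parcs H \<and> (a \<in> {2..j + 1} \<or> b \<in> {2..j + 1}) \<longleftrightarrow>
      a = 1 \<and> b \<in> {2..j + 1}" for a b
    using H(3) by (auto simp: set_eq_iff)
  have range: "i \<in> {2..Suc j + 1} \<longleftrightarrow> i = j + 2 \<or> i \<in> {2..j + 1}" for i by auto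
  have "{(a, b) \<in> parcs H'. a \<in> {2..Suc j + 1} \<or> b \<in> {2..Suc j + 1}} = {1} \<times> {2..Suc j + 1}"
  proof (intro set_eqI, clarify)
    fix a b
    show "(a, b) \<in> {(a, b) \<in> parcs H'. a \<in> {2..Suc j + 1} \<or> b \<in> {2..Suc j + 1}} \<longleftrightarrow>
        (a, b) \<in> {1} \<times> {2..Suc j + 1}"
      using iff[of a b] unfolding H'_def parcs_moran_update mem_Sigma_iff mem_Collect_eq
        prod.case insert_iff singleton_iff prod.inject range by auto
  qed
  moreover have "H' \<in> digraphs_on n"
    using moran_step_digraphs_on[OF n H(2)] H' by blast
  ultimately show ?case using H(1) H' by (auto simp: chain_law_Suc)
qed

text \<open>After all of \<open>2, \<dots>, n\<close> have been treated nothing of the initial graph is left, because an arc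
that avoids these vertices would be a loop at 1.\<close>
lemma star_reachable:
  assumes "n \<ge> 2" "G \<in> digraphs_on n"
  shows "star n \<in> set_pmf (chain_law (moran_step n) (n - 1) G)"
proof -
  obtain H where H: "H \<in> set_pmf (chain_law (moran_step n) (n - 1) G)" "H \<in> digraphs_on n"
    "{(a, b) \<in> parcs H. a \<in> {2..n} \<or> b \<in> {2..n}} = {1} \<times> {2..n}"
    using partial_star_reachable[OF assms(2), of "n - 1"] assms(1) by auto
  have "parcs H = {(a, b) \<in> parcs H. a \<in> {2..n} \<or> b \<in> {2..n}}"
  proof -
    have "a \<in> {2..n} \<or> b \<in> {2..n}" if "(a, b) \<in> parcs H" for a b
    proof -
      have "a \<in> {1..n}" "b \<in> {1..n}" "a \<noteq> b" using that H(2) by (auto simp: digraphs_on_iff)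
      then show ?thesis by auto
    qed
    then show ?thesis by auto
  qed
  with H have "H = star n" by (simp add: star_def digraphs_on_iff)
  with H(1) show ?thesis by simp
qed

lemma finite_doeblin_chain_moran:
  assumes "n \<ge> 2" "S \<in> {digraphs_on n, oriented_graphs_on n}"
  shows "finite_doeblin_chain (moran_step n) S (star n) (n - 1)"
proof
  have sub: "oriented_graphs_on n \<subseteq> digraphs_on n" by (auto simp: oriented_graphs_on_def)
  then show "finite S" using assms(2) finite_digraphs_on finite_subset by blast
  show "star n \<in> S" using star_oriented[OF assms(1)] sub assms(2) by blast
  show "set_pmf (moran_step n G) \<subseteq> S" if "G \<in> S" for G
    using that assms moran_step_digraphs_on moran_step_oriented_graphs_on by blast
  show "star n \<in> set_pmf (chain_law (moran_step n) (n - 1) G)" if "G \<in> S" for G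
    using that sub assms star_reachable by blast
qed

text \<open>Both the set of all graphs and the set of oriented graphs satisfy the hypotheses of the convergence
theorem. Existence on the smaller set and uniqueness on the larger one show that the stationary law
is carried by the oriented graphs.\<close>
lemma moran_forest_stationary:
  assumes "n \<ge> 2"
  shows "set_pmf (moran_forest n) \<subseteq> oriented_graphs_on n"
    and "bind_pmf (moran_forest n) (moran_step n) = moran_forest n"
proof -
  have sub: "oriented_graphs_on n \<subseteq> digraphs_on n" by (auto simp: oriented_graphs_on_def)
  obtain P where P: "set_pmf P \<subseteq> oriented_graphs_on n" "bind_pmf P (moran_step n) = P"
    using finite_doeblin_chain.stationary_exists[OF finite_doeblin_chain_moran[OF assms]] by blast
  have "moran_forest n = P"
    unfolding moran_forest_def
  proof (rule the_equality)
    show "moran_stationary n P"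
      unfolding moran_stationary_def using P sub by (metis order_trans)
    show "Q = P" if "moran_stationary n Q" for Q
    proof (rule finite_doeblin_chain.stationary_unique)
      show "finite_doeblin_chain (moran_step n) (digraphs_on n) (star n) (n - 1)"
        by (rule finite_doeblin_chain_moran[OF assms]) simp
    qed (use that P sub in \<open>unfold moran_stationary_def, fast+\<close>)
  qed
  with P show "set_pmf (moran_forest n) \<subseteq> oriented_graphs_on n"
    "bind_pmf (moran_forest n) (moran_step n) = moran_forest n" by simp_all
qed

section \<open>The degree of a fixed vertex as a Markov chain\<close>

definition neighbours :: "nat pair_pre_digraph \<Rightarrow> nat \<Rightarrow> nat set" where
  "neighbours G v = {w. (v, w) \<in> parcs G \<or> (w, v) \<in> parcs G}"

lemma neighbours_subset: "G \<in> digraphs_on n \<Longrightarrow> neighbours G v \<subseteq> {1..n} - {v}"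
  by (auto simp: neighbours_def digraphs_on_iff)

lemma total_degree_eq_card_neighbours:
  assumes "G \<in> oriented_graphs_on n"
  shows "total_degree G v = card (neighbours G v)"
proof -
  define X Y where "X = {w. (w, v) \<in> parcs G}" and "Y = {w. (v, w) \<in> parcs G}"
  have "neighbours G v = X \<union> Y" by (auto simp: neighbours_def X_def Y_def)
  moreover have "finite (neighbours G v)"
    using assms neighbours_subset[of G n v] finite_subset by (auto simp: oriented_graphs_on_def)
  moreover have "X \<inter> Y = {}" using assms by (auto simp: oriented_graphs_on_def X_def Y_def)
  ultimately have "card (neighbours G v) = card X + card Y" by (simp add: card_Un_disjoint)
  moreover have "in_arcs (with_proj G) v = (\<lambda>w. (w, v)) ` X"
    "out_arcs (with_proj G) v = Pair v ` Y"
    by (auto simp: X_def Y_def in_arcs_def out_arcs_def)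
  ultimately show ?thesis
    by (simp add: total_degree_def in_degree_def out_degree_def card_image inj_on_def)
qed

lemma neighbours_moran_update:
  assumes "G \<in> digraphs_on n" "u \<noteq> w"
  shows "neighbours (moran_update (u, w) G) v =
    (if w = v then {u} else if u = v then insert w (neighbours G v) else neighbours G v - {w})"
  using assms by (auto simp: neighbours_def)

text \<open>Up to the factor \<open>n(n - 1)\<close>, the transition operator of the degree of a fixed vertex \<open>v\<close>,
applied to \<open>f\<close>. The first term comes from the \<open>n - 1\<close> pairs whose target is \<open>v\<close>. The other two
collect, for each other target \<open>w\<close>, the pair \<open>(v, w)\<close> and the \<open>n - 2\<close> pairs \<open>(u, w)\<close> with \<open>u \<noteq> v\<close>,
according to whether \<open>w\<close> is one of the \<open>d\<close> neighbours of \<open>v\<close> or not. At \<open>d = 0\<close> the truncated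
\<open>d - 1\<close> is harmless because its coefficient vanishes.\<close>
definition degree_transition :: "nat \<Rightarrow> (nat \<Rightarrow> real) \<Rightarrow> nat \<Rightarrow> real" where
  "degree_transition n f d =
    (real n - 1) * f 1 + real d * (f d + (real n - 2) * f (d - 1))
      + (real n - 1 - real d) * (f (d + 1) + (real n - 2) * f d)"

text \<open>The degree of \<open>v\<close> is itself a Markov chain: the transition probabilities depend on the graph
only through the number of neighbours of \<open>v\<close>.\<close>
lemma expectation_degree_step:
  assumes n: "n \<ge> 2" and v: "v \<in> {1..n}" and G: "G \<in> oriented_graphs_on n"
  shows "real n * (real n - 1) *
      measure_pmf.expectation (moran_step n G) (\<lambda>H. f (total_degree H v)) =
    degree_transition n f (total_degree G v)"
proof -
  define N where "N = neighbours G v"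
  define d where "d = card N"
  have dig: "G \<in> digraphs_on n" using G by (simp add: oriented_graphs_on_def)
  have N: "N \<subseteq> {1..n} - {v}" using neighbours_subset[OF dig] by (simp add: N_def)
  then have finN: "finite N" using finite_subset by blast
  have card_others: "card ({1..n} - {v}) = n - 1" using v by simp
  have d_le: "d \<le> n - 1" unfolding d_def card_others[symmetric] using N by (intro card_mono) auto
  have deg: "total_degree (moran_update (u, w) G) v =
      (if w = v then 1 else if u = v then card (insert w N) else card (N - {w}))"
    if "u \<in> {1..n}" "w \<in> {1..n}" "u \<noteq> w" for u w
  proof -
    have "moran_update (u, w) G \<in> oriented_graphs_on n"
      using moran_step_oriented_graphs_on[OF n G] that by (auto simp: set_moran_step[OF n] vertex_pairs_def)
    then show ?thesis
      by (simp add: total_degree_eq_card_neighbours neighbours_moran_update[OF dig that(3)] N_def)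
  qed
  have "(\<Sum>w\<in>{1..n}. \<Sum>u\<in>{1..n} - {w}. f (total_degree (moran_update (u, w) G) v)) =
      (\<Sum>w\<in>{1..n}. \<Sum>u\<in>{1..n} - {w}.
        f (if w = v then 1 else if u = v then card (insert w N) else card (N - {w})))"
    by (intro sum.cong refl) (simp add: deg)
  also have "\<dots> = (\<Sum>u\<in>{1..n} - {v}. f 1) +
      (\<Sum>w\<in>{1..n} - {v}. \<Sum>u\<in>{1..n} - {w}.
        f (if u = v then card (insert w N) else card (N - {w})))"
    using v by (subst sum.remove[of _ v]) (auto intro!: sum.cong)
  also have "(\<Sum>u\<in>{1..n} - {v}. f 1) = (real n - 1) * f 1"
    using n card_others by (simp add: of_nat_diff)
  also have "(\<Sum>w\<in>{1..n} - {v}. \<Sum>u\<in>{1..n} - {w}.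
        f (if u = v then card (insert w N) else card (N - {w}))) =
      (\<Sum>w\<in>{1..n} - {v}. f (card (insert w N)) + (real n - 2) * f (card (N - {w})))"
  proof (intro sum.cong refl)
    fix w assume w: "w \<in> {1..n} - {v}"
    have "(\<Sum>u\<in>{1..n} - {w}. f (if u = v then card (insert w N) else card (N - {w}))) =
        f (card (insert w N)) + (\<Sum>u\<in>{1..n} - {w} - {v}. f (card (N - {w})))"
      using v w by (subst sum.remove[of _ v]) auto
    also have "card ({1..n} - {w} - {v}) = n - 2" using v w by simp
    then have "(\<Sum>u\<in>{1..n} - {w} - {v}. f (card (N - {w}))) = (real n - 2) * f (card (N - {w}))"
      using n by (simp add: of_nat_diff)
    finally show "(\<Sum>u\<in>{1..n} - {w}. f (if u = v then card (insert w N) else card (N - {w}))) =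
        f (card (insert w N)) + (real n - 2) * f (card (N - {w}))" .
  qed
  also have "\<dots> = (\<Sum>w\<in>{1..n} - {v} - N. f (card (insert w N)) + (real n - 2) * f (card (N - {w})))
      + (\<Sum>w\<in>N. f (card (insert w N)) + (real n - 2) * f (card (N - {w})))"
    using N by (intro sum.subset_diff) auto
  also have "(\<Sum>w\<in>N. f (card (insert w N)) + (real n - 2) * f (card (N - {w}))) =
      (\<Sum>w\<in>N. f d + (real n - 2) * f (d - 1))"
    using finN by (intro sum.cong refl) (simp add: d_def insert_absorb)
  also have "\<dots> = real d * (f d + (real n - 2) * f (d - 1))"
    by (simp add: d_def)
  also have "(\<Sum>w\<in>{1..n} - {v} - N. f (card (insert w N)) + (real n - 2) * f (card (N - {w}))) =
      (\<Sum>w\<in>{1..n} - {v} - N. f (d + 1) + (real n - 2) * f d)"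
    using finN by (intro sum.cong refl) (simp add: d_def)
  also have "card ({1..n} - {v} - N) = n - 1 - d"
    using N finN card_others by (simp add: card_Diff_subset d_def)
  then have "(\<Sum>w\<in>{1..n} - {v} - N. f (d + 1) + (real n - 2) * f d) =
      (real n - 1 - real d) * (f (d + 1) + (real n - 2) * f d)"
    using d_le n by (simp add: of_nat_diff)
  finally show ?thesis
    using n by (simp add: expectation_moran_step total_degree_eq_card_neighbours[OF G]
        degree_transition_def flip: N_def d_def)
qed

lemma degree_le:
  assumes "G \<in> oriented_graphs_on n" "v \<in> {1..n}"
  shows "total_degree G v \<le> n - 1"
proof -
  have "card (neighbours G v) \<le> card ({1..n} - {v})"
    using assms neighbours_subset by (intro card_mono) (auto simp: oriented_graphs_on_def)
  with assms show ?thesis by (simp add: total_degree_eq_card_neighbours)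
qed

section \<open>Binomial moments of the stationary degree\<close>

lemma finite_moran_forest: "n \<ge> 2 \<Longrightarrow> finite (set_pmf (moran_forest n))"
  using moran_forest_stationary(1) finite_digraphs_on
  by (metis (no_types, lifting) finite_subset oriented_graphs_on_def mem_Collect_eq subsetI)

lemma integrable_moran_forest:
  fixes f :: "nat pair_pre_digraph \<Rightarrow> 'b::{banach, second_countable_topology}"
  shows "n \<ge> 2 \<Longrightarrow> integrable (measure_pmf (moran_forest n)) f"
  by (intro integrable_measure_pmf_finite finite_moran_forest)

lemma degree_balance:
  assumes n: "n \<ge> 2" and v: "v \<in> {1..n}"
  shows "real n * (real n - 1) *
      measure_pmf.expectation (moran_forest n) (\<lambda>F. f (total_degree F v)) =
    measure_pmf.expectation (moran_forest n) (\<lambda>F. degree_transition n f (total_degree F v))"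
proof -
  let ?P = "moran_forest n" and ?c = "real n * (real n - 1)"
  have "measure_pmf.expectation ?P (\<lambda>F. f (total_degree F v)) =
      measure_pmf.expectation (bind_pmf ?P (moran_step n)) (\<lambda>F. f (total_degree F v))"
    by (simp add: moran_forest_stationary(2)[OF n])
  also have "\<dots> = (\<Sum>G\<in>set_pmf ?P. pmf ?P G *\<^sub>R
      measure_pmf.expectation (moran_step n G) (\<lambda>F. f (total_degree F v)))"
    using finite_moran_forest[OF n]
    by (intro pmf_expectation_bind) (auto simp: set_moran_step[OF n] finite_vertex_pairs)
  finally have "?c * measure_pmf.expectation ?P (\<lambda>F. f (total_degree F v)) =
      (\<Sum>G\<in>set_pmf ?P. pmf ?P G *\<^sub>R
        (?c * measure_pmf.expectation (moran_step n G) (\<lambda>F. f (total_degree F v))))"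
    by (simp add: sum_distrib_left mult_ac)
  also have "\<dots> = (\<Sum>G\<in>set_pmf ?P. pmf ?P G *\<^sub>R degree_transition n f (total_degree G v))"
    using moran_forest_stationary(1)[OF n]
    by (intro sum.cong refl) (subst expectation_degree_step[OF n v], auto)
  also have "\<dots> = measure_pmf.expectation ?P (\<lambda>F. degree_transition n f (total_degree F v))"
    using finite_moran_forest[OF n] by (intro integral_measure_pmf[symmetric]) auto
  finally show ?thesis .
qed

lemma Suc_times_binomial_Suc_real:
  "(real k + 1) * real (d choose Suc k) = (real d - real k) * real (d choose k)"
proof (cases "k \<le> d")
  case True
  have "Suc k * (d choose Suc k) = (d - k) * (d choose k)"
    using binomial_absorb_comp[of d k] binomial_absorption[of k d] by simp
  then have "real (Suc k) * real (d choose Suc k) = (real d - real k) * real (d choose k)"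
    using True by (metis of_nat_diff of_nat_mult)
  then show ?thesis by (simp add: algebra_simps)
qed (simp add: binomial_eq_0)

text \<open>The binomial coefficients \<open>d choose k\<close> triangularise the degree chain. Differences of them in \<open>d\<close>
lower \<open>k\<close> by one, and the factor \<open>d\<close> from the transition rates is absorbed again, so that
apart from the constant contributed by the reset to degree 1 only the orders \<open>k\<close> and \<open>k - 1\<close>
appear.\<close>
lemma degree_transition_binomial:
  assumes "k \<ge> 1"
  shows "degree_transition n (\<lambda>d. real (d choose k)) d =
    (real n * (real n - 1) - (real k + 1) * (real n - 1)) * real (d choose k)
      + (real n - real k) * real (d choose (k - 1)) + (real n - 1) * real (1 choose k)"
proof -
  obtain j where k: "k = Suc j" using assms by (cases k) auto
  \<comment> \<open>The effects of a degree increase (Pascal) and decrease, and the absorption of a factor \<open>d\<close>.\<close>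
  have up: "real (Suc d choose k) = real (d choose k) + real (d choose j)"
    by (simp add: k)
  have absorb: "real d * real (d choose j) =
      real k * real (d choose k) + real j * real (d choose j)"
    using Suc_times_binomial_Suc_real[of j d] by (simp add: k algebra_simps)
  have down: "real d * real ((d - 1) choose k) = (real d - real k) * real (d choose k)"
  proof (cases "k \<le> d")
    case True
    then show ?thesis
      using arg_cong[OF binomial_absorb_comp[of d k], of real] by (simp add: of_nat_diff)
  qed (simp add: binomial_eq_0)
  have "degree_transition n (\<lambda>d. real (d choose k)) d =
      (real n - 1) * real (1 choose k) + real d * real (d choose k)
      + (real n - 2) * (real d * real ((d - 1) choose k))
      + (real n - 1 - real d) * (real (Suc d choose k) + (real n - 2) * real (d choose k))"
    by (simp add: degree_transition_def algebra_simps)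
  also have "\<dots> = (real n - 1) * real (1 choose k) + real d * real (d choose k)
      + (real n - 2) * ((real d - real k) * real (d choose k))
      + (real n - 1 - real d) * ((real n - 1) * real (d choose k))
      + ((real n - 1) * real (d choose j) - real d * real (d choose j))"
    unfolding down up by (simp add: algebra_simps)
  also have "\<dots> = (real n * (real n - 1) - (real k + 1) * (real n - 1)) * real (d choose k)
      + (real n - real k) * real (d choose (k - 1)) + (real n - 1) * real (1 choose k)"
    unfolding absorb by (simp add: k algebra_simps)
  finally show ?thesis .
qed

text \<open>The factorial moments divided by \<open>k!\<close>; these are the Taylor coefficients at 1 of the
generating function.\<close>
definition degree_binomial_moment :: "nat \<Rightarrow> nat \<Rightarrow> nat \<Rightarrow> real" where
  "degree_binomial_moment n v k =
    measure_pmf.expectation (moran_forest n) (\<lambda>F. real (total_degree F v choose k))"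

lemma degree_binomial_moment_0: "degree_binomial_moment n v 0 = 1"
  by (simp add: degree_binomial_moment_def)

lemma degree_binomial_moment_rec:
  assumes n: "n \<ge> 2" and v: "v \<in> {1..n}" and k: "k \<ge> 1"
  shows "(real k + 1) * (real n - 1) * degree_binomial_moment n v k =
    (real n - real k) * degree_binomial_moment n v (k - 1) + (real n - 1) * real (1 choose k)"
proof -
  have "real n * (real n - 1) * degree_binomial_moment n v k =
      (real n * (real n - 1) - (real k + 1) * (real n - 1)) * degree_binomial_moment n v k
      + (real n - real k) * degree_binomial_moment n v (k - 1) + (real n - 1) * real (1 choose k)"
    using degree_balance[OF n v, of "\<lambda>d. real (d choose k)"]
    unfolding degree_transition_binomial[OF k]
    by (simp add: degree_binomial_moment_def integrable_moran_forest[OF n])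
  then show ?thesis by (simp add: algebra_simps)
qed

lemma degree_binomial_moment_1: 
  assumes "n \<ge> 2" "v \<in> {1..n}"
  shows "degree_binomial_moment n v 1 = 1"
  using degree_binomial_moment_rec[OF assms, of 1] assms(1) by (simp add: degree_binomial_moment_0)

text \<open>The correction at \<open>k = 0\<close> is the summand 1 that turns the generating function \<open>G\<close> into the
function \<open>G + 1\<close>, whose coefficients in powers of \<open>(z - 1) / (n - 1)\<close> are proportional to binomial
coefficients. It also absorbs the inhomogeneous term that the recursion has at \<open>k = 1\<close>.\<close>
lemma degree_binomial_moment_closed_form:
  assumes "n \<ge> 2" "v \<in> {1..n}"
  shows "real n * (real n - 1) ^ k * (degree_binomial_moment n v k + (if k = 0 then 1 else 0)) =
    2 * real (n choose Suc k)"
proof (induction k)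
  case 0
  then show ?case by (simp add: degree_binomial_moment_0)
next
  case (Suc k)
  define N where "N = real n - 1"
  have absorb: "(real k + 2) * real (n choose Suc (Suc k)) = (real n - real k - 1) * real (n choose Suc k)"
    using Suc_times_binomial_Suc_real[of "Suc k" n] by (simp add: algebra_simps)
  have rec: "(real k + 2) * N * degree_binomial_moment n v (Suc k) =
      (real n - real k - 1) * (degree_binomial_moment n v k + (if k = 0 then 1 else 0))"
    using degree_binomial_moment_rec[OF assms, of "Suc k"] by (cases "k = 0") (simp_all add: N_def algebra_simps binomial_eq_0)
  have "(real k + 2) * (real n * N ^ Suc k * degree_binomial_moment n v (Suc k)) =
      real n * N ^ k * ((real k + 2) * N * degree_binomial_moment n v (Suc k))"
    by simp
  also have "\<dots> = (real n - real k - 1) *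
      (real n * N ^ k * (degree_binomial_moment n v k + (if k = 0 then 1 else 0)))"
    unfolding rec by simp
  also have "\<dots> = (real k + 2) * (2 * real (n choose Suc (Suc k)))"
    using Suc absorb by (simp add: N_def)
  finally show ?case
    by (simp add: N_def)
qed

section \<open>The generating function\<close>

lemma degree_pgf_moments:
  assumes n: "n \<ge> 2" and v: "v \<in> {1..n}"
  shows "moran_degree_pgf n v (1 + w) = (\<Sum>k<n. of_real (degree_binomial_moment n v k) * w ^ k)"
proof -
  have "(1 + w) ^ d = (\<Sum>k<n. of_real (real (d choose k)) * w ^ k)" if "d \<le> n - 1" for d
  proof -
    have "(1 + w) ^ d = (\<Sum>k\<le>d. of_real (real (d choose k)) * w ^ k)"
      using binomial_ring[of w 1 d] by (simp add: add.commute)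
    also have "\<dots> = (\<Sum>k<n. of_real (real (d choose k)) * w ^ k)"
      using that n by (intro sum.mono_neutral_left) auto
    finally show ?thesis .
  qed
  then have "moran_degree_pgf n v (1 + w) = measure_pmf.expectation (moran_forest n)
      (\<lambda>F. \<Sum>k<n. of_real (real (total_degree F v choose k)) * w ^ k)"
    unfolding moran_degree_pgf_def using moran_forest_stationary(1)[OF n] degree_le v
    by (intro integral_cong_AE) (auto simp: AE_measure_pmf_iff)
  also have "\<dots> = (\<Sum>k<n. of_real (degree_binomial_moment n v k) * w ^ k)"
    by (simp add: Bochner_Integration.integral_sum integrable_moran_forest[OF n] degree_binomial_moment_def
        flip: integral_complex_of_real)
  finally show ?thesis .
qed

text \<open>In the variable \<open>x = (z - 1) / (n - 1)\<close> all powers of \<open>n - 1\<close> cancel, and the right-hand side is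
twice the polynomial \<open>((1 + x)^n - 1) / x\<close>.\<close>
lemma degree_pgf_binomial:
  assumes n: "n \<ge> 2" and v: "v \<in> {1..n}"
  shows "of_nat n * (moran_degree_pgf n v (1 + (of_nat n - 1) * x) + 1) =
    2 * (\<Sum>k<n. of_nat (n choose Suc k) * x ^ k)"
proof -
  let ?\<mu> = "\<lambda>k. degree_binomial_moment n v k + (if k = 0 then 1 else 0)"
  have "moran_degree_pgf n v (1 + (of_nat n - 1) * x) + 1 =
      (\<Sum>k<n. of_real (degree_binomial_moment n v k) * ((of_nat n - 1) * x) ^ k) +
      (\<Sum>k<n. if k = 0 then 1 else 0)"
    using n by (simp add: degree_pgf_moments[OF assms])
  also have "\<dots> = (\<Sum>k<n. of_real (?\<mu> k) * ((of_nat n - 1) * x) ^ k)"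
    unfolding sum.distrib[symmetric] by (intro sum.cong) auto
  finally have "of_nat n * (moran_degree_pgf n v (1 + (of_nat n - 1) * x) + 1) =
      (\<Sum>k<n. of_real (real n * (real n - 1) ^ k * ?\<mu> k) * x ^ k)"
    by (simp add: sum_distrib_left power_mult_distrib mult_ac)
  also have "\<dots> = (\<Sum>k<n. of_real (2 * real (n choose Suc k)) * x ^ k)"
    unfolding degree_binomial_moment_closed_form[OF assms] ..
  finally show ?thesis by (simp add: sum_distrib_left mult_ac)
qed

lemma sum_binomial_Suc_shift:
  fixes x :: "'a::comm_ring_1"
  shows "x * (\<Sum>k<n. of_nat (n choose Suc k) * x ^ k) = (1 + x) ^ n - 1"
proof -
  have "(1 + x) ^ n = (\<Sum>k\<le>n. of_nat (n choose k) * x ^ k)"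
    using binomial_ring[of x 1 n] by (simp add: add.commute)
  also have "\<dots> = 1 + (\<Sum>k<n. of_nat (n choose Suc k) * x ^ Suc k)"
    by (subst sum.atMost_shift) simp
  finally show ?thesis by (simp add: sum_distrib_left mult_ac)
qed

lemma sum_binomial_Suc_eq_geometric:
  fixes x :: "'a::field"
  shows "(\<Sum>k<n. of_nat (n choose Suc k) * x ^ k) = (\<Sum>l<n. (1 + x) ^ l)"
proof (cases "x = 0")
  case True
  then show ?thesis by (simp add: power_0_left if_distrib cong: if_cong)
next
  case False
  have "x * (\<Sum>l<n. (1 + x) ^ l) = (1 + x) ^ n - 1"
    using power_diff_1_eq[of "1 + x" n] by simp
  with False show ?thesis
    using sum_binomial_Suc_shift[of x n] by (metis mult_left_cancel)
qed

text \<open>With \<open>q = 1 + x\<close>, the difference of the left-hand summand and \<open>2 q^l\<close> is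
\<open>(c - l) q^(l+1) - (c - l + 1) q^l\<close>, which telescopes. Keeping \<open>c\<close> separate from \<open>m\<close> makes this
visible to the induction; for \<open>c = m - 1\<close> the boundary term at \<open>m\<close> vanishes.\<close>
lemma weighted_geometric_sum:
  fixes x :: "'a::comm_ring_1"
  shows "(\<Sum>l<m. (1 + (c - of_nat l) * x) * (1 + x) ^ l) =
    2 * (\<Sum>l<m. (1 + x) ^ l) + (c - of_nat m + 1) * (1 + x) ^ m - (c + 1)"
  by (induction m) (simp_all add: algebra_simps)

lemma of_nat_minus_1_nonzero:
  assumes "n \<ge> 2"
  shows "of_nat n - 1 \<noteq> (0::'a::ring_char_0)"
  using assms of_nat_eq_1_iff[of n, where ?'a = 'a] by auto

lemma degree_pgf_geometric:
  assumes n: "n \<ge> 2" and v: "v \<in> {1..n}"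
  shows "moran_degree_pgf n v z =
    1 / of_nat n * (\<Sum>l = 0..n - 1.
      (1 + (1 - of_nat l / (of_nat n - 1)) * (z - 1)) *
      (1 + 1 / (of_nat n - 1) * (z - 1)) ^ l)"
proof -
  define N where "N = (of_nat n - 1 :: complex)"
  define x where "x = (z - 1) / N"
  have N: "N \<noteq> 0" using n by (simp add: N_def of_nat_minus_1_nonzero)
  then have z: "z = 1 + N * x" by (simp add: x_def)
  have "(\<Sum>l = 0..n - 1. (1 + (1 - of_nat l / (of_nat n - 1)) * (z - 1)) *
      (1 + 1 / (of_nat n - 1) * (z - 1)) ^ l) =
    (\<Sum>l<n. (1 + (N - of_nat l) * x) * (1 + x) ^ l)"
    using N n unfolding N_def[symmetric]
    by (intro sum.cong) (auto simp: x_def field_simps)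
  also have "\<dots> = 2 * (\<Sum>l<n. (1 + x) ^ l) - of_nat n"
    by (simp add: weighted_geometric_sum N_def)
  also have "\<dots> = of_nat n * moran_degree_pgf n v z"
    using degree_pgf_binomial[OF assms, of x]
    unfolding sum_binomial_Suc_eq_geometric N_def[symmetric] z[symmetric]
    by (simp add: algebra_simps)
  finally show ?thesis using n by simp
qed

lemma degree_pgf_quotient:
  assumes n: "n \<ge> 2" and v: "v \<in> {1..n}" and "z \<noteq> 1"
  shows "moran_degree_pgf n v z = 2 * (1 - 1 / of_nat n) *
    (((1 + (z - 1) / (of_nat n - 1)) ^ n - 1) / (z - 1)) - 1"
proof -
  define N where "N = (of_nat n - 1 :: complex)"
  define x where "x = (z - 1) / N"
  have N: "N \<noteq> 0" using n by (simp add: N_def of_nat_minus_1_nonzero)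
  then have z: "z = 1 + N * x" by (simp add: x_def)
  then have x: "x \<noteq> 0" using \<open>z \<noteq> 1\<close> by auto
  have n0: "of_nat n \<noteq> (0::complex)" using n by simp
  have "of_nat n * (x * (moran_degree_pgf n v z + 1)) =
      2 * (x * (\<Sum>k<n. of_nat (n choose Suc k) * x ^ k))"
    using degree_pgf_binomial[OF n v, of x] unfolding N_def[symmetric] z[symmetric]
    by (simp add: mult.left_commute)
  then have "of_nat n * (x * (moran_degree_pgf n v z + 1)) = 2 * ((1 + x) ^ n - 1)"
    by (simp add: sum_binomial_Suc_shift)
  then have "moran_degree_pgf n v z + 1 = 2 * ((1 + x) ^ n - 1) / (of_nat n * x)"
    using x n0 by (simp add: field_simps)
  also have "\<dots> = 2 * (N / of_nat n) * (((1 + x) ^ n - 1) / (N * x))"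
    using N by simp
  also have "N / of_nat n = 1 - 1 / of_nat n" using n0 by (simp add: N_def field_simps)
  also have "N * x = z - 1" by (simp add: z)
  finally show ?thesis unfolding x_def N_def by (simp add: eq_diff_eq)
qed

text \<open>The degree is bounded, so the generating function is a polynomial. The quotient formula away from
1 therefore determines its value at 1 by continuity.\<close>
lemma continuous_degree_pgf:
  assumes "n \<ge> 2" and "v \<in> {1..n}"
  shows "isCont (moran_degree_pgf n v) z"
proof -
  have "moran_degree_pgf n v =
      (\<lambda>z. \<Sum>k<n. of_real (degree_binomial_moment n v k) * (z - 1) ^ k)"
    using degree_pgf_moments[OF assms, of "z - 1" for z] by (simp add: fun_eq_iff)
  then show ?thesis by simp
qed

theorem proposition4p1:
  fixes n v :: nat
  assumes "n \<ge> 2" and "v \<in> {1..n}"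
  shows "measure_pmf.expectation (moran_forest n) (\<lambda>F. real (total_degree F v)) = 1 \<and>
         measure_pmf.variance (moran_forest n) (\<lambda>F. real (total_degree F v))
           = 2 * (real n - 2) / (3 * (real n - 1)) \<and>
         (\<forall>z::complex. moran_degree_pgf n v z =
           1 / of_nat n * (\<Sum>l = 0..n - 1.
             (1 + (1 - of_nat l / (of_nat n - 1)) * (z - 1)) *
             (1 + 1 / (of_nat n - 1) * (z - 1)) ^ l)) \<and>
         (\<forall>z::complex. z \<noteq> 1 \<longrightarrow> moran_degree_pgf n v z =
           2 * (1 - 1 / of_nat n) *
             (((1 + (z - 1) / (of_nat n - 1)) ^ n - 1) / (z - 1)) - 1) \<and>
         ((\<lambda>z::complex. 2 * (1 - 1 / of_nat n) *
             (((1 + (z - 1) / (of_nat n - 1)) ^ n - 1) / (z - 1)) - 1)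
           \<longlongrightarrow> moran_degree_pgf n v 1) (at 1)"
proof (intro conjI allI impI)
  let ?P = "moran_forest n"
  show mean: "measure_pmf.expectation ?P (\<lambda>F. real (total_degree F v)) = 1"
    using degree_binomial_moment_1[OF assms] by (simp add: degree_binomial_moment_def)
  have "degree_binomial_moment n v 2 = (real n - 2) / (3 * (real n - 1))"
    using degree_binomial_moment_rec[OF assms, of 2] degree_binomial_moment_1[OF assms] assms(1)
    by (simp add: field_simps binomial_eq_0)
  moreover have "(real d)\<^sup>2 = 2 * real (d choose 2) + real d" for d
    by (induction d) (simp_all add: numeral_2_eq_2 algebra_simps)
  then have "measure_pmf.expectation ?P (\<lambda>F. (real (total_degree F v))\<^sup>2) =
      2 * degree_binomial_moment n v 2 + 1"
    using mean by (simp add: degree_binomial_moment_def integrable_moran_forest[OF assms(1)])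
  ultimately show "measure_pmf.variance ?P (\<lambda>F. real (total_degree F v)) =
      2 * (real n - 2) / (3 * (real n - 1))"
    by (subst measure_pmf.variance_eq) (simp_all add: mean integrable_moran_forest[OF assms(1)])
next
  show "moran_degree_pgf n v z = 1 / of_nat n * (\<Sum>l = 0..n - 1.
      (1 + (1 - of_nat l / (of_nat n - 1)) * (z - 1)) *
      (1 + 1 / (of_nat n - 1) * (z - 1)) ^ l)" for z
    using assms by (rule degree_pgf_geometric)
next
  show "moran_degree_pgf n v z = 2 * (1 - 1 / of_nat n) *
      (((1 + (z - 1) / (of_nat n - 1)) ^ n - 1) / (z - 1)) - 1" if "z \<noteq> 1" for z
    using assms that by (rule degree_pgf_quotient)
next
  have "(moran_degree_pgf n v \<longlongrightarrow> moran_degree_pgf n v 1) (at 1)"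
    using continuous_degree_pgf[OF assms] by (simp add: isCont_def)
  then show "((\<lambda>z::complex. 2 * (1 - 1 / of_nat n) *
      (((1 + (z - 1) / (of_nat n - 1)) ^ n - 1) / (z - 1)) - 1)
      \<longlongrightarrow> moran_degree_pgf n v 1) (at 1)"
    by (rule Lim_transform_eventually)
       (auto simp: eventually_at_filter degree_pgf_quotient[OF assms])
qed

end
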